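(* Let $n\ge 5$ and $T_{5,n}=C_5\Box C_n$. Then $\chi(T_{5,n}^2)=5$ if $n\equiv 0\pmod 5$; $\chi(T_{5,7}^2)=7$; and $\chi(T_{5,n}^2)=6$ otherwise (i.e. if $n\not\equiv 0\pmod 5$ and $n\ne 7$).
   Context: $C_j$ denotes the cycle on $j$ vertices; $\Box$ is the Cartesian product of graphs. The square $G^2$ of a graph $G$ has vertex set $V(G)$, two distinct vertices being adjacent iff their distance in $G$ is at most 2. $\chi$ is the chromatic number. *)

theory Defs
  imports "Graph_Theory.Graph_Theory" "HOL-Number_Theory.Cong"
begin

text \<open>
  Finite simple graphs are represented as in the Graph_Theory library: a \<open>pair_pre_digraph\<close>
  satisfying \<open>pair_graph\<close>, with each undirected edge given by its two opposite arcs.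
\<close>

text \<open>The cycle on \<open>n\<close> vertices; for \<open>n < 3\<close> this is not a simple cycle.\<close>

definition cycle_graph :: "nat \<Rightarrow> nat pair_pre_digraph" where
  "cycle_graph n =
     \<lparr> pverts = {..<n},
       parcs = {(i, j). i < n \<and> j < n \<and> (j = (i + 1) mod n \<or> i = (j + 1) mod n)} \<rparr>"

definition box_product ::
    "'a pair_pre_digraph \<Rightarrow> 'b pair_pre_digraph \<Rightarrow> ('a \<times> 'b) pair_pre_digraph"
    (infixr "\<box>" 75) where
  "G \<box> H =
     \<lparr> pverts = pverts G \<times> pverts H,
       parcs = {((u, u'), (v, v')).
                  (u \<in> pverts G \<and> u = v \<and> (u', v') \<in> parcs H) \<or>
                  ((u, v) \<in> parcs G \<and> u' \<in> pverts H \<and> u' = v')} \<rparr>"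

text \<open>With unit weights the shortest path distance \<open>\<mu>\<close> is the usual graph distance
  (\<open>\<infinity>\<close> for vertices in different components); it is only meaningful for well-formed \<open>G\<close>,
  because \<open>\<mu>\<close> is defined inside the locale \<open>wf_digraph\<close>.\<close>

definition graph_dist :: "'a pair_pre_digraph \<Rightarrow> 'a \<Rightarrow> 'a \<Rightarrow> ereal" where
  "graph_dist G u v = wf_digraph.\<mu> (with_proj G) (\<lambda>_. 1) u v"

definition graph_square :: "'a pair_pre_digraph \<Rightarrow> 'a pair_pre_digraph" where
  "graph_square G =
     \<lparr> pverts = pverts G,
       parcs = {(u, v). u \<in> pverts G \<and> v \<in> pverts G \<and> u \<noteq> v \<and> graph_dist G u v \<le> 2} \<rparr>"

definition proper_coloring :: "'a pair_pre_digraph \<Rightarrow> nat \<Rightarrow> ('a \<Rightarrow> nat) \<Rightarrow> bool" where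
  "proper_coloring G k c \<longleftrightarrow>
     (\<forall>v \<in> pverts G. c v < k) \<and> (\<forall>(u, v) \<in> parcs G. c u \<noteq> c v)"

definition chromatic_number :: "'a pair_pre_digraph \<Rightarrow> nat" where
  "chromatic_number G = (LEAST k. \<exists>c. proper_coloring G k c)"

definition torus :: "nat \<Rightarrow> nat \<Rightarrow> (nat \<times> nat) pair_pre_digraph" where
  "torus m n = cycle_graph m \<box> cycle_graph n"

lemma pair_graph_cycle_graph:
  assumes "n \<ge> 2"
  shows "pair_graph (cycle_graph n)"
proof
  have *: "i \<noteq> Suc i mod n" if "i < n" for i
    using assms that by (cases "Suc i = n") auto
  show "finite (parcs (cycle_graph n))"
    by (rule finite_subset[of _ "{..<n} \<times> {..<n}"]) (auto simp: cycle_graph_def)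
  show "fst e \<noteq> snd e" if "e \<in> parcs (cycle_graph n)" for e
    using that * by (cases e) (auto simp: cycle_graph_def)
  show "symmetric (with_proj (cycle_graph n))"
    by (auto simp: symmetric_def cycle_graph_def intro!: symI)
qed (auto simp: cycle_graph_def)

lemma pair_graph_box_product:
  assumes "pair_graph G" "pair_graph H"
  shows "pair_graph (G \<box> H)"
proof -
  interpret G: pair_graph G by fact
  interpret H: pair_graph H by fact
  have sub: "parcs (G \<box> H) \<subseteq> (pverts G \<times> pverts H) \<times> (pverts G \<times> pverts H)"
    by (auto simp: box_product_def dest: G.wellformed' H.wellformed')
  show ?thesis
  proof
    show "finite (parcs (G \<box> H))"
      using finite_subset[OF sub] G.pair_finite_verts H.pair_finite_verts by blast
    show "fst e \<in> pverts (G \<box> H)" "snd e \<in> pverts (G \<box> H)" if "e \<in> parcs (G \<box> H)" for e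
      using subsetD[OF sub that] by (cases e; auto simp: box_product_def)+
    show "fst e \<noteq> snd e" if "e \<in> parcs (G \<box> H)" for e
      using that G.no_loops' H.no_loops' by (auto simp: box_product_def)
    show "symmetric (with_proj (G \<box> H))"
      using G.pair_sym_arcs H.pair_sym_arcs
      by (auto simp: symmetric_def box_product_def sym_def)
  qed (use G.pair_finite_verts H.pair_finite_verts in \<open>simp add: box_product_def\<close>)
qed

lemma pair_graph_torus: "m \<ge> 2 \<Longrightarrow> n \<ge> 2 \<Longrightarrow> pair_graph (torus m n)"
  unfolding torus_def by (intro pair_graph_box_product pair_graph_cycle_graph)

lemma (in pair_wf_digraph) graph_dist_le_iff:
  "graph_dist G u v \<le> ereal (real k) \<longleftrightarrow> (\<exists>p. awalk u p v \<and> length p \<le> k)"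
proof
  have cost: "awalk_cost (\<lambda>_. 1) p = real (length p)" for p :: "('a \<times> 'a) list"
    by (induction p) auto
  { assume "\<exists>p. awalk u p v \<and> length p \<le> k"
    then obtain p where "awalk u p v" "length p \<le> k" by blast
    then show "graph_dist G u v \<le> ereal (real k)"
      using min_cost_le_walk_cost[of u p v "\<lambda>_. 1"] unfolding graph_dist_def cost
      by (meson ereal_less_eq(3) of_nat_le_iff order_trans) }
  { assume "graph_dist G u v \<le> ereal (real k)"
    then have "graph_dist G u v < ereal (real (Suc k))"
      by (rule le_less_trans) simp
    then obtain p where "awalk u p v" "real (length p) < real (Suc k)"
      unfolding graph_dist_def \<mu>_def cost by (auto simp: INF_less_iff)
    then show "\<exists>p. awalk u p v \<and> length p \<le> k" by (auto simp: less_Suc_eq_le) }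
qed

lemma (in pair_graph) graph_square_arcs_iff:
  "(u, v) \<in> parcs (graph_square G) \<longleftrightarrow>
     u \<noteq> v \<and> ((u, v) \<in> parcs G \<or> (\<exists>w. (u, w) \<in> parcs G \<and> (w, v) \<in> parcs G))"
proof -
  have "(\<exists>p. awalk u p v \<and> length p \<le> 2) \<longleftrightarrow>
      (u = v \<and> u \<in> pverts G) \<or> (u, v) \<in> parcs G \<or>
      (\<exists>w. (u, w) \<in> parcs G \<and> (w, v) \<in> parcs G)" (is "?L \<longleftrightarrow> ?R")
  proof
    assume ?L
    then obtain p where p: "awalk u p v" "length p \<le> 2" by blast
    then consider "p = []" | e where "p = [e]" | e f where "p = [e, f]"
      by (cases p; cases "tl p") auto
    then show ?R
      using p by cases (auto simp: awalk_Cons_iff awalk_Nil_iff)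
  next
    assume ?R
    then consider "awalk u [] v" | "awalk u [(u, v)] v" | w where "awalk u [(u, w), (w, v)] v"
      by (auto simp: awalk_Cons_iff awalk_Nil_iff dest: wellformed')
    then show ?L
      by cases force+
  qed
  then show ?thesis
    using graph_dist_le_iff[of u v 2]
    by (auto simp: graph_square_def dest: wellformed')
qed

lemma pair_graph_graph_square:
  assumes "pair_graph G"
  shows "pair_graph (graph_square G)"
proof -
  interpret pair_graph G by fact
  show ?thesis
  proof
    show "finite (parcs (graph_square G))"
      by (rule finite_subset[of _ "pverts G \<times> pverts G"])
        (auto simp: graph_square_def pair_finite_verts)
    show "symmetric (with_proj (graph_square G))"
      using pair_sym_arcs unfolding symmetric_def with_proj_simps
      by (intro symI) (unfold graph_square_arcs_iff, blast dest: symD)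
  qed (auto simp: graph_square_def pair_finite_verts)
qed

lemma (in pair_graph) ex_proper_coloring_chromatic_number:
  "\<exists>c. proper_coloring G (chromatic_number G) c"
proof -
  obtain f where f: "bij_betw f (pverts G) {0..<card (pverts G)}"
    using ex_bij_betw_finite_nat[OF pair_finite_verts] by blast
  have arcs: "f u \<noteq> f v" if "(u, v) \<in> parcs G" for u v
    using f wellformed'[OF that] no_loops'[OF that]
    by (meson bij_betw_def inj_onD)
  have "f v < card (pverts G)" if "v \<in> pverts G" for v
    using bij_betw_apply[OF f that] by simp
  with arcs have "proper_coloring G (card (pverts G)) f"
    unfolding proper_coloring_def by blast
  then show ?thesis
    unfolding chromatic_number_def
    using LeastI[where P = "\<lambda>k. \<exists>c. proper_coloring G k c"] by blast
qed

end

theory Submission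
  imports Defs
begin

text \<open>
  Every column \<open>C\<^sub>5 \<times> {j}\<close> is a clique of the square, so a colour occurs at most once per column.
  If a colour occurs in consecutive columns, its row has to move by \<open>2\<close> or \<open>3\<close> modulo \<open>5\<close> at each
  step, and the step may not change because rows two columns apart differ. Hence a colour present
  in all columns forces \<open>5\<close> to divide \<open>n\<close>, which excludes five colours otherwise; and for \<open>n = 7\<close>
  a colour present in six consecutive columns would return to its row after five steps, at
  distance two from its start, so colour classes have at most \<open>5\<close> elements and \<open>6 \<cdot> 5 < 35\<close>.
  For the upper bounds, the five columns of the \<open>5\<close>-colouring \<open>i + 2j\<close> can be inserted in front of
  the first two of these columns, so it suffices to give colourings for \<open>n = 5, 8, 9, 11, 12\<close>
  containing those two columns, and separate ones for \<open>n = 6, 7\<close>.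
\<close>

section \<open>Adjacency in the square of the torus\<close>

lemma parcs_torus_iff:
  "((i, j), (i', j')) \<in> parcs (torus m n) \<longleftrightarrow>
     (i < m \<and> i = i' \<and> (j, j') \<in> parcs (cycle_graph n)) \<or>
     ((i, i') \<in> parcs (cycle_graph m) \<and> j < n \<and> j = j')"
  by (auto simp: torus_def box_product_def cycle_graph_def)

lemma parcs_cycle_graph_iff:
  "(i, j) \<in> parcs (cycle_graph n) \<longleftrightarrow> i < n \<and> j < n \<and> (j = (i + 1) mod n \<or> i = (j + 1) mod n)"
  by (auto simp: cycle_graph_def)

text \<open>Two steps in the same direction add up to a shift by 2; opposite steps cancel, since the
  successor modulo \<open>n\<close> is injective.\<close>

lemma cycle_graph_two_steps:
  assumes "(i, k) \<in> parcs (cycle_graph n)" "(k, j) \<in> parcs (cycle_graph n)"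
  shows "i = j \<or> j = (i + 2) mod n \<or> i = (j + 2) mod n"
proof -
  have inj: "i = j" if "i < n" "j < n" "Suc i mod n = Suc j mod n"
    using that by (cases "Suc i = n"; cases "Suc j = n") auto
  have two: "Suc (Suc a mod n) mod n = (a + 2) mod n" for a
    by (simp add: mod_Suc_eq)
  show ?thesis
    using assms inj two by (auto simp: parcs_cycle_graph_iff)
qed

lemma less_5_cases: "(i :: nat) < 5 \<longleftrightarrow> i = 0 \<or> i = 1 \<or> i = 2 \<or> i = 3 \<or> i = 4"
  by auto

lemma all_less_5_iff: "(\<forall>i<5::nat. P i) \<longleftrightarrow> P 0 \<and> P 1 \<and> P 2 \<and> P 3 \<and> P 4"
  unfolding less_5_cases by blast

lemma pred_mod_5_iff:
  fixes i j :: nat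
  assumes "i < 5" "j < 5"
  shows "i = (j + 1) mod 5 \<longleftrightarrow> j = (i + 4) mod 5"
  using assms unfolding less_5_cases by (elim disjE) simp_all

lemma two_or_three_steps_mod_5:
  fixes i j :: nat
  assumes "i < 5" "j < 5" "j \<notin> {i, (i + 1) mod 5, (i + 4) mod 5}"
  shows "j = (i + 2) mod 5 \<or> j = (i + 3) mod 5"
  using assms unfolding less_5_cases by (elim disjE) simp_all

lemma parcs_cycle_graph_5:
  "(i, j) \<in> parcs (cycle_graph 5) \<longleftrightarrow> i < 5 \<and> (j = (i + 1) mod 5 \<or> j = (i + 4) mod 5)"
  using pred_mod_5_iff[of i j] by (auto simp: parcs_cycle_graph_iff)

text \<open>The differences 2 and 3 are 1 + 1 and 4 + 4 modulo 5. This makes every column a clique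
  of the square.\<close>

lemma cycle_graph_5_diameter:
  assumes "i < 5" "i' < 5" "i \<noteq> i'" "(i, i') \<notin> parcs (cycle_graph 5)"
  shows "\<exists>k. (i, k) \<in> parcs (cycle_graph 5) \<and> (k, i') \<in> parcs (cycle_graph 5)"
proof -
  have "i' = (i + 2) mod 5 \<or> i' = (i + 3) mod 5"
    using assms by (intro two_or_three_steps_mod_5) (auto simp: parcs_cycle_graph_5)
  then show ?thesis
  proof
    assume "i' = (i + 2) mod 5"
    with assms show ?thesis
      by (intro exI[of _ "(i + 1) mod 5"]) (auto simp: parcs_cycle_graph_5 mod_simps)
  next
    assume "i' = (i + 3) mod 5"
    then have "i' = ((i + 4) mod 5 + 4) mod 5"
      by presburger
    with assms show ?thesis
      by (intro exI[of _ "(i + 4) mod 5"]) (auto simp: parcs_cycle_graph_5)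
  qed
qed

text \<open>Conflicts with the next two columns, in one orientation only;
  \<open>(i + 4) mod 5\<close> is the row before \<open>i\<close>, written without
  subtraction.\<close>

definition ahead :: "nat \<Rightarrow> nat \<times> nat \<Rightarrow> nat \<times> nat \<Rightarrow> bool" where
  "ahead n = (\<lambda>(i, j) (i', j').
     (j' = (j + 1) mod n \<and> i' \<in> {i, (i + 1) mod 5, (i + 4) mod 5}) \<or> (j' = (j + 2) mod n \<and> i' = i))"

text \<open>Two steps between different columns either stay in one row or split into one step in
  each factor.\<close>

lemma parcs_square_torus_imp:
  assumes "n \<ge> 2" and uv: "((i, j), (i', j')) \<in> parcs (graph_square (torus 5 n))"
  shows "i < 5 \<and> i' < 5 \<and> j < n \<and> j' < n \<and>
    ((j = j' \<and> i \<noteq> i') \<or> ahead n (i, j) (i', j') \<or> ahead n (i', j') (i, j))"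
proof -
  interpret pair_graph "torus 5 n"
    using assms by (intro pair_graph_torus) auto
  have ne: "(i, j) \<noteq> (i', j')"
    and or: "((i, j), (i', j')) \<in> parcs (torus 5 n) \<or>
      (\<exists>k l. ((i, j), (k, l)) \<in> parcs (torus 5 n) \<and> ((k, l), (i', j')) \<in> parcs (torus 5 n))"
    using uv unfolding graph_square_arcs_iff by auto
  have prev: "a = (b + 1) mod 5 \<or> a = (b + 4) mod 5"
    if "(a, b) \<in> parcs (cycle_graph 5)" for a b
    using that pred_mod_5_iff[of b a] by (auto simp: parcs_cycle_graph_iff)
  have bounds: "i < 5 \<and> i' < 5 \<and> j < n \<and> j' < n"
    using or by (auto simp: parcs_torus_iff parcs_cycle_graph_iff)
  have "(j = j' \<and> i \<noteq> i') \<or> ahead n (i, j) (i', j') \<or> ahead n (i', j') (i, j)"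
    using or
  proof (elim disjE exE conjE)
    assume "((i, j), (i', j')) \<in> parcs (torus 5 n)"
    then show ?thesis
      using ne by (auto simp: parcs_torus_iff ahead_def parcs_cycle_graph_iff)
  next
    fix k l
    assume 1: "((i, j), (k, l)) \<in> parcs (torus 5 n)" and 2: "((k, l), (i', j')) \<in> parcs (torus 5 n)"
    show ?thesis
    proof (cases "j = j'")
      case True
      with ne show ?thesis by auto
    next
      case False
      with 1 2 consider
          "i = i'" "(j, l) \<in> parcs (cycle_graph n)" "(l, j') \<in> parcs (cycle_graph n)"
        | "(i, i') \<in> parcs (cycle_graph 5)" "(j, j') \<in> parcs (cycle_graph n)"
        unfolding parcs_torus_iff by blast
      then show ?thesis
      proof cases
        case 1
        with False cycle_graph_two_steps[of j l n j'] show ?thesis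
          by (auto simp: ahead_def)
      next
        case 2
        with prev[of i i'] show ?thesis
          by (auto simp: ahead_def parcs_cycle_graph_iff[of j] parcs_cycle_graph_5)
      qed
    qed
  qed
  with bounds show ?thesis by blast
qed

lemma column_imp_parcs_square_torus:
  assumes "n \<ge> 2" "i < 5" "i' < 5" "i \<noteq> i'" "j < n"
  shows "((i, j), (i', j)) \<in> parcs (graph_square (torus 5 n))"
proof -
  interpret pair_graph "torus 5 n"
    using assms by (intro pair_graph_torus) auto
  show ?thesis
    using assms cycle_graph_5_diameter[of i i']
    unfolding graph_square_arcs_iff parcs_torus_iff by (auto simp: parcs_torus_iff)
qed

lemma ahead_imp_parcs_square_torus:
  assumes "n \<ge> 3" "i < 5" "j < n" and ahead: "ahead n (i, j) (i', j')"
  shows "((i, j), (i', j')) \<in> parcs (graph_square (torus 5 n))"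
proof -
  interpret pair_graph "torus 5 n"
    using assms by (intro pair_graph_torus) auto
  have step: "(a mod n, Suc a mod n) \<in> parcs (cycle_graph n)" for a
    using assms by (auto simp: parcs_cycle_graph_iff mod_Suc_eq)
  have 1: "(j, (j + 1) mod n) \<in> parcs (cycle_graph n)"
    and 2: "((j + 1) mod n, (j + 2) mod n) \<in> parcs (cycle_graph n)"
    using step[of j] step[of "j + 1"] assms by auto
  \<comment> \<open>Here \<open>n \<ge> 3\<close> matters: for \<open>n = 2\<close> the column two
    ahead would be \<open>j\<close> itself.\<close>
  have "j \<noteq> (j + 1) mod n" "j \<noteq> (j + 2) mod n"
    using assms by (auto simp: mod_if)
  then have ne: "(i, j) \<noteq> (i', j')"
    using ahead by (auto simp: ahead_def)
  have "((i, j), (i', j')) \<in> parcs (torus 5 n) \<or>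
      (\<exists>w. ((i, j), w) \<in> parcs (torus 5 n) \<and> (w, (i', j')) \<in> parcs (torus 5 n))"
  proof -
    consider "j' = (j + 1) mod n" "i' = i"
      | "j' = (j + 1) mod n" "(i, i') \<in> parcs (cycle_graph 5)"
      | "j' = (j + 2) mod n" "i' = i"
      using ahead assms by (auto simp: ahead_def parcs_cycle_graph_5)
    then show ?thesis
    proof cases
      case 1
      with \<open>(j, (j + 1) mod n) \<in> _\<close> assms show ?thesis
        by (simp add: parcs_torus_iff)
    next
      case 2
      with 1 assms show ?thesis
        \<comment> \<open>The row changes first, within column \<open>j\<close>; then the column
          advances.\<close>
        by (intro disjI2 exI[of _ "(i', j)"])
          (auto simp: parcs_torus_iff parcs_cycle_graph_iff[of i])
    next
      case 3
      with 1 2 assms show ?thesis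
        by (intro disjI2 exI[of _ "(i, (j + 1) mod n)"]) (auto simp: parcs_torus_iff)
    qed
  qed
  with ne show ?thesis
    unfolding graph_square_arcs_iff by blast
qed

section \<open>Lower bounds\<close>

text \<open>Here \<open>f t i\<close> is the colour of row \<open>i\<close> in column \<open>t\<close>, with the columns unrolled periodically,
  and \<open>p t\<close> is the row of a fixed colour \<open>a\<close>.\<close>

lemma constant_drift:
  fixes f :: "nat \<Rightarrow> nat \<Rightarrow> nat" and p :: "nat \<Rightarrow> nat"
  assumes p: "\<And>t. t \<le> m \<Longrightarrow> p t < 5 \<and> f t (p t) = a"
    and f1: "\<And>t i i'. i < 5 \<Longrightarrow> i' \<in> {i, (i + 1) mod 5, (i + 4) mod 5} \<Longrightarrow> f t i \<noteq> f (t + 1) i'"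
    and f2: "\<And>t i. i < 5 \<Longrightarrow> f t i \<noteq> f (t + 2) i"
  shows "\<exists>d. \<not> 5 dvd d \<and> (\<forall>t\<le>m. p t = (p 0 + d * t) mod 5)"
proof (cases "m = 0")
  case True
  \<comment> \<open>A single column only says \<open>p 0 < 5\<close>, so any step prime to 5
    serves.\<close>
  with p[of 0] show ?thesis by (intro exI[of _ 1]) auto
next
  case False
  have step: "p (t + 1) = (p t + 2) mod 5 \<or> p (t + 1) = (p t + 3) mod 5" if "t + 1 \<le> m" for t
  proof -
    have "p (t + 1) \<notin> {p t, (p t + 1) mod 5, (p t + 4) mod 5}"
      using f1[of "p t" "p (t + 1)" t] p[of t] p[of "t + 1"] that by auto
    moreover have "p t < 5" "p (t + 1) < 5"
      using p[of t] p[of "t + 1"] that by auto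
    ultimately show ?thesis
      by (intro two_or_three_steps_mod_5)
  qed
  have return: "p (t + 2) \<noteq> p t" if "t + 2 \<le> m" for t
    using f2[of "p t" t] p[of t] p[of "t + 2"] that by auto
  obtain d where d: "d = 2 \<or> d = 3" "p 1 = (p 0 + d) mod 5"
    using step[of 0] False that[of 2] that[of 3] by auto
  \<comment> \<open>Since 2 + 3 = 5, a change of the step would lead back to the row occupied two
    columns earlier, against \<open>return\<close>.\<close>
  have drift: "p (t + 1) = (p t + d) mod 5" if "t + 1 \<le> m" for t
    using that
  proof (induction t)
    case 0
    with d show ?case by simp
  next
    case (Suc t)
    have "p (Suc t) = (p t + d) mod 5" "p t < 5"
      using Suc p[of t] by auto
    moreover have "p (Suc t + 1) \<noteq> p t"
      using return[of t] Suc.prems by simp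
    moreover have "p (Suc t + 1) = (p (Suc t) + 2) mod 5 \<or> p (Suc t + 1) = (p (Suc t) + 3) mod 5"
      using step[of "Suc t"] Suc.prems by simp
    ultimately show ?case
      using d(1) by (auto simp: mod_simps)
  qed
  have "p t = (p 0 + d * t) mod 5" if "t \<le> m" for t
    using that
  proof (induction t)
    case 0
    with p[of 0] show ?case by simp
  next
    case (Suc t)
    then show ?case
      using drift[of t] by (simp add: mod_simps algebra_simps)
  qed
  moreover have "\<not> 5 dvd d"
    using d(1) by auto
  ultimately show ?thesis by blast
qed

context
  fixes n k :: nat and c :: "nat \<times> nat \<Rightarrow> nat"
  assumes n: "n \<ge> 3" and c: "proper_coloring (graph_square (torus 5 n)) k c"
begin

lemma coloring_bound: "i < 5 \<Longrightarrow> j < n \<Longrightarrow> c (i, j) < k"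
  using c by (auto simp: proper_coloring_def graph_square_def torus_def box_product_def
      cycle_graph_def)

lemma coloring_arcs: "(u, v) \<in> parcs (graph_square (torus 5 n)) \<Longrightarrow> c u \<noteq> c v"
  using c by (auto simp: proper_coloring_def)

lemma coloring_column:
  assumes "j < n"
  shows "inj_on (\<lambda>i. c (i, j)) {..<5}"
proof (rule inj_onI, rule ccontr)
  fix i i' :: nat
  assume "i \<in> {..<5}" "i' \<in> {..<5}" "i \<noteq> i'"
  then have "c (i, j) \<noteq> c (i', j)"
    using n assms by (intro coloring_arcs column_imp_parcs_square_torus) auto
  moreover assume "c (i, j) = c (i', j)"
  ultimately show False by contradiction
qed

text \<open>The columns are read cyclically from \<open>s\<close>, and \<open>m\<close> is
  unrestricted, so the colour may be followed all the way around the torus.\<close>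

lemma coloring_drift:
  assumes "\<And>t. t \<le> m \<Longrightarrow> p t < 5 \<and> c (p t, (s + t) mod n) = a"
  shows "\<exists>d. \<not> 5 dvd d \<and> (\<forall>t\<le>m. p t = (p 0 + d * t) mod 5)"
proof (rule constant_drift[where f = "\<lambda>t i. c (i, (s + t) mod n)"])
  have ahead: "c (i, t mod n) \<noteq> c (i', t')" if "i < 5" "ahead n (i, t mod n) (i', t')" for i t i' t'
    using that n by (intro coloring_arcs ahead_imp_parcs_square_torus) auto
  show "c (i, (s + t) mod n) \<noteq> c (i', (s + (t + 1)) mod n)"
    if "i < 5" "i' \<in> {i, (i + 1) mod 5, (i + 4) mod 5}" for t i i'
    using that by (intro ahead) (auto simp: ahead_def mod_simps add.assoc)
  show "c (i, (s + t) mod n) \<noteq> c (i, (s + (t + 2)) mod n)" if "i < 5" for t i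
    using that by (intro ahead) (auto simp: ahead_def mod_simps add.assoc)
qed (use assms in auto)

lemma coloring_ge_5: "5 \<le> k"
  using card_inj_on_le[OF coloring_column[of 0], of "{..<k}"] coloring_bound[of _ 0] n by auto

lemma five_coloring_imp_dvd:
  assumes "k = 5"
  shows "5 dvd n"
proof -
  have "\<exists>i<5. c (i, j) = 0" if "j < n" for j
  proof -
    \<comment> \<open>Five distinct colours below 5 exhaust the palette, so colour 0 occurs in each
      column.\<close>
    have "(\<lambda>i. c (i, j)) ` {..<5} = {..<5}"
      using coloring_bound that assms coloring_column[OF that]
      by (intro card_subset_eq) (auto simp: card_image)
    then have "0 \<in> (\<lambda>i. c (i, j)) ` {..<5}" by simp
    then show ?thesis by auto
  qed
  then obtain q where q: "\<And>j. j < n \<Longrightarrow> q j < 5 \<and> c (q j, j) = 0"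
    by metis
  \<comment> \<open>With \<open>m = n\<close> the last step lands in column 0 again, so
    \<open>d * n\<close> must vanish modulo 5.\<close>
  have "\<exists>d. \<not> 5 dvd d \<and> (\<forall>t\<le>n. q (t mod n) = (q (0 mod n) + d * t) mod 5)"
    using q n by (intro coloring_drift[where s = 0 and a = 0]) auto
  then obtain d where d: "\<not> 5 dvd d" "q (n mod n) = (q (0 mod n) + d * n) mod 5"
    by blast
  have "q 0 < 5"
    using q n by simp
  then have "[q 0 + d * n = q 0 + 0] (mod 5)"
    using d(2) by (simp add: cong_def)
  then have "5 dvd d * n"
    by (simp only: cong_add_lcancel_nat cong_0_iff)
  moreover have "prime (5 :: nat)" by simp
  ultimately show ?thesis
    using d(1) by (simp add: prime_dvd_mult_iff)
qed

lemma color_class_card_le_5: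
  assumes "n = 7"
  shows "card {v \<in> {..<5} \<times> {..<7}. c v = a} \<le> 5" (is "card ?A \<le> 5")
proof (rule ccontr)
  assume "\<not> card ?A \<le> 5"
  moreover have "inj_on snd ?A"
    using coloring_column assms by (auto simp: inj_on_def)
  ultimately have "6 \<le> card (snd ` ?A)"
    by (simp add: card_image)
  then have "card ({..<7} - snd ` ?A) \<le> Suc 0"
    by (subst card_Diff_subset) auto
  then have "\<forall>x\<in>{..<7} - snd ` ?A. \<forall>y\<in>{..<7} - snd ` ?A. x = y"
    by (subst (asm) card_le_Suc0_iff_eq) (rule finite_Diff, simp, assumption)
  \<comment> \<open>\<open>s\<close> is the column without colour \<open>a\<close>; if there is
    none, any value serves. The six columns after \<open>s\<close> all contain
    \<open>a\<close>.\<close>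
  then obtain s where s: "{..<7} - snd ` ?A \<subseteq> {s}"
    by (cases "{..<7} - snd ` ?A = {}") blast+
  have "\<exists>i<5. c (i, (s + 1 + t) mod 7) = a" if "t \<le> 5" for t
  proof -
    have "(s + 1 + t) mod 7 \<noteq> s"
      using that by presburger
    moreover have "(s + 1 + t) mod 7 \<in> {..<7}"
      by simp
    ultimately have "(s + 1 + t) mod 7 \<in> snd ` ?A"
      using s by blast
    then show ?thesis by auto
  qed
  then obtain p where p: "\<And>t. t \<le> 5 \<Longrightarrow> p t < 5 \<and> c (p t, (s + 1 + t) mod n) = a"
    unfolding assms by metis
  obtain d where d: "\<forall>t\<le>5. p t = (p 0 + d * t) mod 5"
    using coloring_drift[of 5, OF p] by blast
  have "p 5 = (p 0 + d * 5) mod 5"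
    by (rule d[rule_format]) simp
  with p[of 0] have "p 5 = p 0"
    by simp
  moreover have "ahead n (p 5, (s + 1 + 5) mod n) (p 5, (s + 1) mod n)"
  proof -
    \<comment> \<open>Two columns beyond \<open>s + 6\<close> lies \<open>s + 8\<close>, which is
      \<open>s + 1\<close> modulo 7.\<close>
    have "(s + 1) mod 7 = ((s + 1 + 5) mod 7 + 2) mod 7"
      by presburger
    then show ?thesis
      unfolding assms ahead_def by blast
  qed
  ultimately have "c (p 5, (s + 1 + 5) mod n) \<noteq> c (p 0, (s + 1) mod n)"
    using p[of 5] n by (intro coloring_arcs ahead_imp_parcs_square_torus) auto
  with p[of 5] p[of 0] show False by simp
qed

lemma coloring_7_ge_7:
  assumes "n = 7"
  shows "7 \<le> k"
proof -
  let ?A = "\<lambda>a. {v \<in> {..<5} \<times> {..<7}. c v = a}"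
  have "{..<5} \<times> {..<7} = (\<Union>a<k. ?A a)"
    using coloring_bound assms by auto
  then have "card ({..<5::nat} \<times> {..<7::nat}) = card (\<Union>a<k. ?A a)"
    by (rule arg_cong)
  also have "\<dots> \<le> (\<Sum>a<k. card (?A a))"
    by (rule card_UN_le) simp
  also have "\<dots> \<le> (\<Sum>a<k. 5)"
    using color_class_card_le_5 assms by (intro sum_mono) auto
  finally show ?thesis by (simp add: card_cartesian_product)
qed

end

section \<open>Colourings by lists of columns\<close>

text \<open>Entry \<open>i\<close> of a list is the colour of row \<open>i\<close>. Only conflicts
  with the two following columns \<open>y\<close> and \<open>z\<close> are recorded, as each
  conflict between columns is seen from one of its ends. In this form concrete colourings can be
  checked by rewriting.\<close>

definition compatible :: "nat \<Rightarrow> nat list \<Rightarrow> nat list \<Rightarrow> nat list \<Rightarrow> bool" where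
  "compatible k x y z \<longleftrightarrow> length x = 5 \<and> distinct x \<and> (\<forall>a\<in>set x. a < k) \<and>
     (\<forall>i<5. x ! i \<notin> {y ! i, y ! ((i + 1) mod 5), y ! ((i + 4) mod 5), z ! i})"

fun windows :: "nat \<Rightarrow> nat list list \<Rightarrow> bool" where
  "windows k (x # y # z # xs) \<longleftrightarrow> compatible k x y z \<and> windows k (y # z # xs)"
| "windows k xs \<longleftrightarrow> True"

lemma windows_nth:
  "windows k xs \<Longrightarrow> j + 2 < length xs \<Longrightarrow> compatible k (xs ! j) (xs ! (j + 1)) (xs ! (j + 2))"
proof (induction k xs arbitrary: j rule: windows.induct)
  case (1 k x y z xs)
  then show ?case by (cases j) auto
qed auto

text \<open>Repeating the first two columns at the end turns the cyclic conditions into windows of a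
  linear list.\<close>

lemma ex_coloring_of_windows:
  assumes "windows k (xs @ take 2 xs)" "length xs = n" "n \<ge> 2"
  shows "\<exists>c. proper_coloring (graph_square (torus 5 n)) k c"
proof
  let ?c = "\<lambda>(i, j). xs ! j ! i"
  have wrap: "(xs @ take 2 xs) ! j = xs ! (j mod n)" if "j < n + 2" for j
  proof (cases "j < n")
    case True
    with assms(2) show ?thesis by (simp add: nth_append)
  next
    case False
    \<comment> \<open>From \<open>n \<ge> 2\<close> follows \<open>j - n < n\<close>, so one
      subtraction reduces \<open>j\<close> modulo \<open>n\<close>.\<close>
    with that assms(2,3) show ?thesis by (simp add: nth_append le_mod_geq)
  qed
  have compat: "compatible k (xs ! j) (xs ! ((j + 1) mod n)) (xs ! ((j + 2) mod n))" if "j < n" for j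
    using windows_nth[OF assms(1), of j] wrap[of j] wrap[of "j + 1"] wrap[of "j + 2"] that assms(2,3)
    by simp
  have neq: "?c (i, j) \<noteq> ?c (i', j')" if "i < 5" "j < n" "ahead n (i, j) (i', j')" for i j i' j'
    using compat[OF that(2)] that(1,3) by (auto simp: compatible_def ahead_def)
  show "proper_coloring (graph_square (torus 5 n)) k ?c"
  proof -
    have "?c (i, j) < k" if "(i, j) \<in> pverts (graph_square (torus 5 n))" for i j
    proof -
      have "i < 5" "j < n"
        using that by (auto simp: graph_square_def torus_def box_product_def cycle_graph_def)
      then show ?thesis
        using compat[of j] by (auto simp: compatible_def)
    qed
    moreover have "?c (i, j) \<noteq> ?c (i', j')"
      if "((i, j), (i', j')) \<in> parcs (graph_square (torus 5 n))" for i j i' j'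
    proof
      assume eq: "?c (i, j) = ?c (i', j')"
      from parcs_square_torus_imp[OF assms(3) that]
      consider "j = j'" "i \<noteq> i'" "i < 5" "i' < 5" "j < n"
        | "i < 5" "j < n" "ahead n (i, j) (i', j')"
        | "i' < 5" "j' < n" "ahead n (i', j') (i, j)"
        by blast
      then show False
      proof cases
        case 1
        with compat[of j] eq show False
          by (auto simp: compatible_def nth_eq_iff_index_eq)
      next
        case 2
        with neq eq show False by blast
      next
        case 3
        with neq[of i' j' i j] eq show False by simp
      qed
    qed
    ultimately show ?thesis
      unfolding proper_coloring_def by (auto split: prod.splits)
  qed
qed

text \<open>The two fixed lists are columns 0 and 1 of the colouring \<open>i + 2j\<close> modulo 5.
  Their copy at the end closes the cycle and is not counted in \<open>n\<close>.\<close>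

definition extendable :: "nat \<Rightarrow> nat \<Rightarrow> bool" where
  "extendable k n \<longleftrightarrow> (\<exists>xs. length xs + 2 = n \<and>
     windows k ([[0,1,2,3,4], [2,3,4,0,1]] @ xs @ [[0,1,2,3,4], [2,3,4,0,1]]))"

lemma extendableI:
  assumes "windows k ([[0,1,2,3,4], [2,3,4,0,1]] @ xs @ [[0,1,2,3,4], [2,3,4,0,1]])" "length xs + 2 = n"
  shows "extendable k n"
  using assms unfolding extendable_def by blast

lemma extendable_imp_ex_coloring:
  assumes "extendable k n"
  shows "\<exists>c. proper_coloring (graph_square (torus 5 n)) k c"
proof -
  obtain xs where xs: "length xs + 2 = n"
    "windows k ([[0,1,2,3,4], [2,3,4,0,1]] @ xs @ [[0,1,2,3,4], [2,3,4,0,1]])"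
    using assms unfolding extendable_def by blast
  then show ?thesis
    by (intro ex_coloring_of_windows[of _ "[0,1,2,3,4] # [2,3,4,0,1] # xs"]) auto
qed

lemma extendable_add_5:
  assumes "extendable k n" "k \<ge> 5"
  shows "extendable k (n + 5)"
proof -
  obtain xs where xs: "length xs + 2 = n"
    "windows k ([[0,1,2,3,4], [2,3,4,0,1]] @ xs @ [[0,1,2,3,4], [2,3,4,0,1]])"
    using assms(1) unfolding extendable_def by blast
  \<comment> \<open>The inserted lists are columns 2, 3, 4 of \<open>i + 2j\<close> modulo 5, then
    columns 0 and 1 again; from there on the windows are the old ones.\<close>
  have "windows k ([[0,1,2,3,4], [2,3,4,0,1]] @
      ([[4,0,1,2,3], [1,2,3,4,0], [3,4,0,1,2], [0,1,2,3,4], [2,3,4,0,1]] @ xs) @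
      [[0,1,2,3,4], [2,3,4,0,1]])"
    using xs(2) assms(2) by (simp add: compatible_def all_less_5_iff)
  then show ?thesis
    by (rule extendableI) (use xs(1) in simp)
qed

lemma extendable_mod_5:
  assumes "extendable k m" "k \<ge> 5" "m \<le> n" "[n = m] (mod 5)"
  shows "extendable k n"
proof -
  have "extendable k (m + 5 * q)" for q
  proof (induction q)
    case (Suc q)
    with extendable_add_5[OF Suc assms(2)] show ?case by (simp add: algebra_simps)
  qed (use assms in simp)
  moreover obtain q where "n = m + 5 * q"
    using assms(3,4) by (metis cong_sym cong_le_nat add.commute mult.commute)
  ultimately show ?thesis by simp
qed

section \<open>Explicit colourings for small \<open>n\<close>\<close>

lemma extendable_5: "extendable 5 5"
  by (rule extendableI[of _ "[[4,0,1,2,3], [1,2,3,4,0], [3,4,0,1,2]]"])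
    (simp_all add: compatible_def all_less_5_iff)

lemma extendable_8: "extendable 6 8"
  by (rule extendableI[of _ "[[4,0,1,2,3], [1,2,3,4,5], [3,4,5,0,2], [5,0,1,3,4], [1,2,4,5,0],
        [3,5,0,1,2]]"])
    (simp_all add: compatible_def all_less_5_iff)

lemma extendable_9: "extendable 6 9"
  by (rule extendableI[of _ "[[4,0,1,2,3], [1,2,3,4,0], [3,4,0,1,5], [2,1,5,3,4], [5,0,4,2,1],
        [4,2,3,5,0], [3,5,0,1,2]]"])
    (simp_all add: compatible_def all_less_5_iff)

lemma extendable_11: "extendable 6 11"
  by (rule extendableI[of _ "[[4,0,1,2,3], [1,2,3,4,0], [3,4,0,1,2], [0,1,2,3,4], [2,3,4,0,5],
        [4,0,5,2,1], [5,2,1,4,3], [1,4,3,5,0], [3,5,0,1,2]]"])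
    (simp_all add: compatible_def all_less_5_iff)

lemma extendable_12: "extendable 6 12"
  by (rule extendableI[of _ "[[4,0,1,2,5], [1,2,5,3,0], [5,3,0,1,4], [0,1,4,5,3], [4,5,3,0,2],
        [3,0,2,4,5], [2,4,5,3,1], [5,3,1,2,4], [1,2,4,5,0], [3,5,0,1,2]]"])
    (simp_all add: compatible_def all_less_5_iff)

text \<open>The list lacks the common column \<open>[2,3,4,0,1]\<close>, so it cannot be lengthened
  by \<open>extendable_add_5\<close>.\<close>

lemma ex_coloring_6: "\<exists>c. proper_coloring (graph_square (torus 5 6)) 6 c"
  by (rule ex_coloring_of_windows[of _ "[[0,1,2,3,4], [2,5,4,0,1], [4,3,1,2,5], [1,0,5,4,3],
        [5,2,3,1,0], [3,4,0,5,2]]"])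
    (simp_all add: compatible_def all_less_5_iff)

text \<open>By \<open>color_class_card_le_5\<close> each of the seven colours must occur exactly
  five times.\<close>

lemma ex_coloring_7: "\<exists>c. proper_coloring (graph_square (torus 5 7)) 7 c"
  by (rule ex_coloring_of_windows[of _ "[[0,1,2,3,4], [2,3,4,0,1], [4,0,1,5,6], [1,5,6,2,3],
        [6,2,3,4,5], [3,4,5,6,0], [5,6,0,1,2]]"])
    (simp_all add: compatible_def all_less_5_iff)

section \<open>Six colours for the remaining \<open>n\<close>, and the chromatic numbers\<close>

lemma ex_six_coloring:
  assumes "n \<ge> 5" "[n \<noteq> 0] (mod 5)" "n \<noteq> 7"
  shows "\<exists>c. proper_coloring (graph_square (torus 5 n)) 6 c"
proof (cases "n = 6")
  case True
  with ex_coloring_6 show ?thesis by simp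
next
  case False
  \<comment> \<open>Residues 1 and 2 start only at 11 and 12, because 6 is treated apart and 7 is
    excluded.\<close>
  have "[n = 11] (mod 5) \<and> 11 \<le> n \<or> [n = 12] (mod 5) \<and> 12 \<le> n \<or>
      [n = 8] (mod 5) \<and> 8 \<le> n \<or> [n = 9] (mod 5) \<and> 9 \<le> n"
    using assms False unfolding cong_def by simp presburger
  then have "extendable 6 n"
    using extendable_mod_5[of 6 _ n] extendable_8 extendable_9 extendable_11 extendable_12 by auto
  then show ?thesis
    by (rule extendable_imp_ex_coloring)
qed

lemma chromatic_number_eqI:
  assumes "\<exists>c. proper_coloring G k c" "\<And>l c. proper_coloring G l c \<Longrightarrow> k \<le> l"
  shows "chromatic_number G = k"
  using assms unfolding chromatic_number_def by (intro Least_equality) auto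

theorem theorem7:
  fixes n :: nat
  assumes "n \<ge> 5"
  shows "([n = 0] (mod 5) \<longrightarrow> chromatic_number (graph_square (torus 5 n)) = 5) \<and>
         chromatic_number (graph_square (torus 5 7)) = 7 \<and>
         ([n \<noteq> 0] (mod 5) \<and> n \<noteq> 7 \<longrightarrow> chromatic_number (graph_square (torus 5 n)) = 6)"
proof (intro conjI impI)
  assume "[n = 0] (mod 5)"
  then have "extendable 5 n"
    using assms by (intro extendable_mod_5[OF extendable_5]) (auto simp: cong_def)
  then show "chromatic_number (graph_square (torus 5 n)) = 5"
    using assms by (intro chromatic_number_eqI extendable_imp_ex_coloring coloring_ge_5[of n]) auto
next
  show "chromatic_number (graph_square (torus 5 7)) = 7"
    by (intro chromatic_number_eqI ex_coloring_7 coloring_7_ge_7[of 7]) auto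
next
  assume n: "[n \<noteq> 0] (mod 5) \<and> n \<noteq> 7"
  show "chromatic_number (graph_square (torus 5 n)) = 6"
  proof (rule chromatic_number_eqI)
    show "\<exists>c. proper_coloring (graph_square (torus 5 n)) 6 c"
      using assms n by (intro ex_six_coloring) auto
    show "6 \<le> l" if "proper_coloring (graph_square (torus 5 n)) l c" for l c
      \<comment> \<open>The value \<open>l = 5\<close> would give \<open>5 dvd n\<close>.\<close>
      using coloring_ge_5[OF _ that] five_coloring_imp_dvd[OF _ that] assms n
      by (fastforce simp: cong_0_iff)
  qed
qed

end
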